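(* Let $p$ be a prime, $n\ge 1$ and $q=p^n$. The number of Costas polynomials over $\mathbb{F}_q$ is at least $$\varphi(q-1)\,\frac{(q-1)(q-p)\cdots(q-p^{n-1})}{n(q-1)}.$$
   Context: $\mathbb{F}_q$ is the finite field of order $q$, and $\varphi$ is Euler's totient function. A permutation polynomial is a polynomial inducing a bijection of $\mathbb{F}_q$. A Costas polynomial over $\mathbb{F}_q$ is a polynomial $f\in\mathbb{F}_q[x]$ with $f(0)=0$ such that $f(dx)-f(x)$ is a permutation polynomial for every $d\in\mathbb{F}_q$, $d\neq 1$. Polynomials are identified with the maps $\mathbb{F}_q\to\mathbb{F}_q$ they induce, i.e. one counts Costas polynomials of degree less than $q$. *)

theory Defs
  imports
    "HOL-Computational_Algebra.Polynomial"
    "HOL-Computational_Algebra.Primes"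
    "HOL-Number_Theory.Totient"
    "HOL-Library.Cardinality"
begin

definition permutation_poly :: "'a::{field,finite} poly \<Rightarrow> bool" where
  "permutation_poly f \<longleftrightarrow> bij (poly f)"

text \<open>The polynomial \<open>f(d x)\<close> is the composition of \<open>f\<close> with \<open>[:0, d:]\<close>.\<close>

definition costas_poly :: "'a::{field,finite} poly \<Rightarrow> bool" where
  "costas_poly f \<longleftrightarrow>
     poly f 0 = 0 \<and> (\<forall>d. d \<noteq> 1 \<longrightarrow> permutation_poly (pcompose f [:0, d:] - f))"

text \<open>Over a field with \<open>q\<close> elements, every self-map is induced by exactly one polynomial of
  degree less than \<open>q\<close>; bounding the degree thus counts Costas polynomials as maps.\<close>

definition costas_polys :: "'a::{field,finite} poly set" where
  "costas_polys = {f. degree f < CARD('a) \<and> costas_poly f}"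

end

theory Submission imports Defs "HOL-Number_Theory.Residues" begin

text \<open>An additive bijection \<open>f\<close> of the field is Costas, because
  \<open>f (d * x) - f x = f ((d - 1) * x)\<close>. Fixing one basis over the prime field, such maps correspond
  to ordered bases, of which there are at least \<open>(q - 1) (q - p) \<dots> (q - p^(n-1))\<close>.
  Since \<open>totient (q - 1) \<le> n (q - 1)\<close>, these maps already give the bound.\<close>

section \<open>Interpolation\<close>

lemma exists_poly_interpolating:
  fixes f :: "'a::{field,finite} \<Rightarrow> 'a"
  shows "\<exists>p. degree p < CARD('a) \<and> poly p = f"
proof -
  \<comment> \<open>Lagrange numerators: \<open>l a\<close> vanishes everywhere except at
    \<open>a\<close>, and omitting the factor for \<open>a\<close> keeps the degree below the field
    size.\<close>
  define l where "l a = (\<Prod>b\<in>UNIV - {a}. [:- b, 1:])" for a :: 'a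
  define p where "p = (\<Sum>a\<in>UNIV. Polynomial.smult (f a / poly (l a) a) (l a))"
  have card: "card (UNIV - {a} :: 'a set) = CARD('a) - 1" for a
    by (simp add: card_Diff_singleton)
  have deg: "degree (l a) \<le> CARD('a) - 1" for a
  proof -
    have "degree (l a) \<le> (\<Sum>b\<in>UNIV - {a}. degree [:- b, 1:])"
      unfolding l_def by (rule order.trans[OF degree_prod_sum_le]) (auto simp: o_def)
    then show ?thesis by (simp add: card)
  qed
  have l_self: "poly (l a) a \<noteq> 0" for a
    by (auto simp: l_def poly_prod)
  have l_other: "poly (l a) x = 0" if "x \<noteq> a" for a x
    using that by (auto simp: l_def poly_prod intro!: prod_zero)
  have "degree p \<le> CARD('a) - 1"
    unfolding p_def by (intro degree_sum_le order.trans[OF degree_smult_le] deg) simp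
  moreover have "CARD('a) > 0" by simp
  ultimately have "degree p < CARD('a)" by linarith
  moreover have "poly p x = f x" for x
  proof -
    have "poly p x = (\<Sum>a\<in>UNIV. if a = x then f a else 0)"
      unfolding p_def poly_sum by (intro sum.cong) (auto simp: l_self l_other)
    then show ?thesis by simp
  qed
  ultimately show ?thesis by blast
qed

lemma costas_poly_of_additive_bij:
  fixes f :: "'a::{field,finite} poly"
  assumes "additive (poly f)" and "bij (poly f)"
  shows "costas_poly f"
  unfolding costas_poly_def permutation_poly_def
proof (intro conjI allI impI)
  show "poly f 0 = 0" using additive.zero[OF assms(1)] .
next
  fix d :: 'a assume "d \<noteq> 1"
  then have "bij (\<lambda>x. (d - 1) * x)"
    by (intro o_bij[where g = "\<lambda>x. x / (d - 1)"]) (auto simp: fun_eq_iff)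
  then have "bij (poly f \<circ> (\<lambda>x. (d - 1) * x))"
    using assms(2) by (rule bij_comp)
  moreover have "poly (pcompose f [:0, d:] - f) = poly f \<circ> (\<lambda>x. (d - 1) * x)"
    by (auto simp: fun_eq_iff poly_pcompose additive.diff[OF assms(1), symmetric] algebra_simps)
  ultimately show "bij (poly (pcompose f [:0, d:] - f))" by simp
qed

section \<open>The prime field\<close>

text \<open>In a finite field the natural multiples of 1 already form the prime subfield:
  \<open>CHAR('a) - 1\<close> represents -1, and finiteness supplies inverses.\<close>

definition prime_field :: "'a::field set" where
  "prime_field = range of_nat"

lemma prime_field_eq_image:
  "(prime_field :: 'a::{field,finite} set) = of_nat ` {..<CHAR('a)}"
proof -
  have "(of_nat m :: 'a) \<in> of_nat ` {..<CHAR('a)}" for m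
  proof (rule image_eqI)
    show "(of_nat m :: 'a) = of_nat (m mod CHAR('a))"
      by (simp add: of_nat_eq_iff_cong_CHAR cong_def)
    show "m mod CHAR('a) \<in> {..<CHAR('a)}"
      by (simp add: finite_imp_CHAR_pos)
  qed
  then show ?thesis unfolding prime_field_def by blast
qed

lemma card_prime_field:
  "card (prime_field :: 'a::{field,finite} set) = CHAR('a)"
proof -
  have "inj_on (of_nat :: nat \<Rightarrow> 'a) {..<CHAR('a)}"
    by (auto simp: inj_on_def of_nat_eq_iff_cong_CHAR cong_def)
  then show ?thesis by (simp add: prime_field_eq_image card_image)
qed

lemma prime_field_0 [simp]: "0 \<in> prime_field"
  unfolding prime_field_def by (metis of_nat_0 rangeI)

lemma prime_field_1 [simp]: "1 \<in> prime_field"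
  unfolding prime_field_def by (metis of_nat_1 rangeI)

lemma prime_field_add: "x \<in> prime_field \<Longrightarrow> y \<in> prime_field \<Longrightarrow> x + y \<in> prime_field"
  unfolding prime_field_def by (auto simp flip: of_nat_add)

lemma prime_field_mult: "x \<in> prime_field \<Longrightarrow> y \<in> prime_field \<Longrightarrow> x * y \<in> prime_field"
  unfolding prime_field_def by (auto simp flip: of_nat_mult)

lemma prime_field_diff:
  fixes x :: "'a::{field,finite}"
  assumes "x \<in> prime_field" and "y \<in> prime_field"
  shows "x - y \<in> prime_field"
proof -
  have "CHAR('a) > 0" by (simp add: finite_imp_CHAR_pos)
  then have "(of_nat (CHAR('a) - 1) :: 'a) = - 1"
    by (simp add: of_nat_diff)
  then have "x - y = x + of_nat (CHAR('a) - 1) * y" by simp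
  also have "\<dots> \<in> prime_field"
    using assms by (intro prime_field_add prime_field_mult) (simp_all add: prime_field_def)
  finally show ?thesis .
qed

text \<open>Multiplication by a nonzero \<open>x\<close> maps the finite prime field injectively
  into itself, so it is onto and hits 1.\<close>

lemma prime_field_inverse:
  fixes x :: "'a::{field,finite}"
  assumes "x \<in> prime_field"
  shows "inverse x \<in> prime_field"
proof (cases "x = 0")
  case False
  then have "inj_on ((*) x) prime_field" by (simp add: inj_on_def)
  then have "(*) x ` prime_field = prime_field"
    using assms by (intro endo_inj_surj) (auto simp: prime_field_mult)
  then obtain y where "y \<in> prime_field" "x * y = 1"
    using prime_field_1 by (metis imageE)
  then show ?thesis using inverse_unique by blast
qed simp

lemma prime_field_divide:
  fixes x :: "'a::{field,finite}"
  shows "x \<in> prime_field \<Longrightarrow> y \<in> prime_field \<Longrightarrow> x / y \<in> prime_field"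
  by (simp add: divide_inverse prime_field_mult prime_field_inverse)

section \<open>Counting independent tuples\<close>

text \<open>Extensionality gives each coordinate vector a single representative, so that counting
  and injectivity make sense. Vectors computed pointwise therefore have to be restricted.\<close>

definition coords :: "nat \<Rightarrow> (nat \<Rightarrow> 'a::field) set" where
  "coords k = {..<k} \<rightarrow>\<^sub>E prime_field"

definition lincomb :: "nat \<Rightarrow> (nat \<Rightarrow> 'a::field) \<Rightarrow> (nat \<Rightarrow> 'a) \<Rightarrow> 'a" where
  "lincomb k b c = (\<Sum>i<k. c i * b i)"

text \<open>Linear independence over the prime field, phrased as uniqueness of coordinates; this
  form yields the size of the span at once.\<close>

definition indep_tuples :: "nat \<Rightarrow> (nat \<Rightarrow> 'a::field) set" where
  "indep_tuples k = {b \<in> {..<k} \<rightarrow>\<^sub>E UNIV. inj_on (lincomb k b) (coords k)}"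

lemma lincomb_restrict [simp]: "lincomb k b (restrict c {..<k}) = lincomb k b c"
  by (simp add: lincomb_def)

lemma restrict_in_coords:
  "(\<And>i. i < k \<Longrightarrow> c i \<in> prime_field) \<Longrightarrow> restrict c {..<k} \<in> coords k"
  by (auto simp: coords_def)

lemma coordsD: "c \<in> coords k \<Longrightarrow> i < k \<Longrightarrow> c i \<in> prime_field"
  by (auto simp: coords_def)

lemma card_coords: "card (coords k :: (nat \<Rightarrow> 'a::{field,finite}) set) = CHAR('a) ^ k"
  by (simp add: coords_def card_PiE card_prime_field)

lemma finite_indep_tuples: "finite (indep_tuples k :: (nat \<Rightarrow> 'a::{field,finite}) set)"
  by (rule finite_subset[of _ "{..<k} \<rightarrow>\<^sub>E UNIV"]) (auto simp: indep_tuples_def finite_PiE)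

lemma indep_tuples_extend:
  fixes b :: "nat \<Rightarrow> 'a::{field,finite}"
  assumes b: "b \<in> indep_tuples k" and v: "v \<notin> lincomb k b ` coords k"
  shows "b(k := v) \<in> indep_tuples (Suc k)"
  unfolding indep_tuples_def
proof (intro CollectI conjI inj_onI)
  show "b(k := v) \<in> {..<Suc k} \<rightarrow>\<^sub>E UNIV"
    using b by (auto simp: indep_tuples_def PiE_def extensional_def)
next
  fix c d :: "nat \<Rightarrow> 'a"
  assume c: "c \<in> coords (Suc k)" and d: "d \<in> coords (Suc k)"
    and "lincomb (Suc k) (b(k := v)) c = lincomb (Suc k) (b(k := v)) d"
  then have eq: "lincomb k b c + c k * v = lincomb k b d + d k * v"
    by (simp add: lincomb_def)
  have top: "c k = d k"
  proof (rule ccontr)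
    assume ne: "c k \<noteq> d k"
    \<comment> \<open>Solving \<open>eq\<close> for \<open>v\<close> gives these coefficients, which
      would place \<open>v\<close> in the span of \<open>b\<close>.\<close>
    define e where "e i = (d i - c i) / (c k - d k)" for i
    have "lincomb k b e = (lincomb k b d - lincomb k b c) / (c k - d k)"
      by (simp add: lincomb_def e_def sum_divide_distrib diff_divide_distrib left_diff_distrib
          flip: sum_subtractf)
    also have "\<dots> = v"
      using eq ne by (simp add: field_simps)
    finally have "v = lincomb k b (restrict e {..<k})" by simp
    moreover have "restrict e {..<k} \<in> coords k"
      using c d unfolding e_def
      by (intro restrict_in_coords prime_field_divide prime_field_diff coordsD[of _ "Suc k"]) auto
    ultimately show False using v by blast
  qed
  have "restrict c {..<k} = restrict d {..<k}"
  proof (rule inj_onD)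
    show "inj_on (lincomb k b) (coords k)" using b by (simp add: indep_tuples_def)
  qed (use eq top c d in \<open>auto intro!: restrict_in_coords coordsD[of _ "Suc k"]\<close>)
  then have "c i = d i" if "i < k" for i
    using that by (metis lessThan_iff restrict_apply')
  with top have "c i = d i" if "i < Suc k" for i
    using that by (auto simp: less_Suc_eq)
  then show "c = d"
    using c d unfolding coords_def by (intro PiE_ext[where k = "{..<Suc k}"]) auto
qed

text \<open>The span of an independent \<open>k\<close>-tuple has exactly
  \<open>CHAR('a) ^ k\<close> elements, and every vector outside it is a valid next entry.\<close>

lemma card_indep_tuples_Suc:
  "card (indep_tuples (Suc k) :: (nat \<Rightarrow> 'a::{field,finite}) set) \<ge>
    card (indep_tuples k :: (nat \<Rightarrow> 'a) set) * (CARD('a) - CHAR('a) ^ k)"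
proof -
  define S where "S = (SIGMA b:(indep_tuples k :: (nat \<Rightarrow> 'a) set). - (lincomb k b ` coords k))"
  have "card (- (lincomb k b ` coords k)) = CARD('a) - CHAR('a) ^ k"
    if "b \<in> indep_tuples k" for b :: "nat \<Rightarrow> 'a"
    using that by (simp add: Compl_eq_Diff_UNIV card_Diff_subset card_image indep_tuples_def card_coords)
  then have "card S = card (indep_tuples k :: (nat \<Rightarrow> 'a) set) * (CARD('a) - CHAR('a) ^ k)"
    unfolding S_def by (subst card_SigmaI) (auto simp: finite_indep_tuples)
  moreover have "card S \<le> card (indep_tuples (Suc k) :: (nat \<Rightarrow> 'a) set)"
  proof (rule card_inj_on_le)
    show "(\<lambda>(b, v). b(k := v)) ` S \<subseteq> indep_tuples (Suc k)"
      unfolding S_def using indep_tuples_extend by auto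
    \<comment> \<open>Position \<open>k\<close> of \<open>b\<close> holds the default value, so the
      update at \<open>k\<close> loses nothing: \<open>v\<close> is read off there, and resetting it
      recovers \<open>b\<close>.\<close>
    have *: "b k = undefined" if "(b, v) \<in> S" for b v
      using that by (auto simp: S_def indep_tuples_def PiE_def extensional_def)
    show "inj_on (\<lambda>(b, v). b(k := v)) S"
    proof (rule inj_onI, clarify)
      fix b v b' v' assume S: "(b, v) \<in> S" "(b', v') \<in> S" and eq: "b(k := v) = b'(k := v')"
      then show "b = b' \<and> v = v'"
        using *[OF S(1)] *[OF S(2)] by (metis fun_upd_eqD fun_upd_triv fun_upd_upd)
    qed
  qed (rule finite_indep_tuples)
  ultimately show ?thesis by simp
qed

lemma card_indep_tuples:
  "card (indep_tuples k :: (nat \<Rightarrow> 'a::{field,finite}) set) \<ge>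
    (\<Prod>i<k. CARD('a) - CHAR('a) ^ i)"
proof (induction k)
  case 0
  \<comment> \<open>Only the empty tuple exists, and it is independent because
    \<open>coords 0\<close> is a singleton; this matches the empty product.\<close>
  have "indep_tuples 0 = {\<lambda>_. undefined :: 'a}"
    by (auto simp: indep_tuples_def coords_def)
  then show ?case by simp
next
  case (Suc k)
  then show ?case
    using card_indep_tuples_Suc[of k, where 'a = 'a] by (simp add: order.trans[OF mult_le_mono1])
qed

section \<open>Additive bijections\<close>

text \<open>The combinations of \<open>n\<close> independent vectors are distinct and as numerous as
  the field elements, so they exhaust the field.\<close>

lemma lincomb_bij_betw:
  fixes b :: "nat \<Rightarrow> 'a::{field,finite}"
  assumes "CARD('a) = CHAR('a) ^ n" and "b \<in> indep_tuples n"
  shows "bij_betw (lincomb n b) (coords n) UNIV"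
proof -
  have inj: "inj_on (lincomb n b) (coords n)" using assms(2) by (simp add: indep_tuples_def)
  then have "lincomb n b ` coords n = UNIV"
    by (intro card_subset_eq) (auto simp: card_image card_coords assms(1))
  with inj show ?thesis by (simp add: bij_betw_def)
qed

text \<open>The map reads off coordinates with respect to \<open>a\<close> and reuses them with
  \<open>b\<close>. Uniqueness of coordinates makes the first step additive.\<close>

lemma additive_change_of_basis:
  fixes b :: "nat \<Rightarrow> 'a::{field,finite}"
  assumes "bij_betw (lincomb n a) (coords n) UNIV"
  shows "additive (lincomb n b \<circ> inv_into (coords n) (lincomb n a))" (is "additive (_ \<circ> ?g)")
proof
  fix x y
  have g: "?g z \<in> coords n" "lincomb n a (?g z) = z" for z
    using assms by (simp_all add: bij_betw_def inv_into_into f_inv_into_f)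
  define c where "c = restrict (\<lambda>i. ?g x i + ?g y i) {..<n}"
  have add: "lincomb n e c = lincomb n e (?g x) + lincomb n e (?g y)" for e
    by (simp add: c_def) (simp add: lincomb_def distrib_right sum.distrib)
  have "c \<in> coords n"
    unfolding c_def by (intro restrict_in_coords prime_field_add coordsD[OF g(1)])
  moreover have "lincomb n a c = x + y" by (simp add: add g)
  ultimately have "?g (x + y) = c"
    using assms by (metis bij_betw_def inv_into_f_f)
  then show "(lincomb n b \<circ> ?g) (x + y) = (lincomb n b \<circ> ?g) x + (lincomb n b \<circ> ?g) y"
    by (simp add: add)
qed

text \<open>Evaluating at the unit coordinate vectors recovers the entries of a tuple. This is why
  distinct bases give distinct additive maps.\<close>

lemma lincomb_tuple_inj:
  fixes b b' :: "nat \<Rightarrow> 'a::field"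
  assumes "b \<in> indep_tuples n" "b' \<in> indep_tuples n"
    and eq: "\<And>c. c \<in> coords n \<Longrightarrow> lincomb n b c = lincomb n b' c"
  shows "b = b'"
proof (rule PiE_ext[where k = "{..<n}"])
  show "b \<in> {..<n} \<rightarrow>\<^sub>E UNIV" "b' \<in> {..<n} \<rightarrow>\<^sub>E UNIV"
    using assms by (auto simp: indep_tuples_def)
next
  fix j assume j: "j \<in> {..<n}"
  have "lincomb n e (restrict (\<lambda>i. if i = j then 1 else 0) {..<n}) = e j" for e :: "nat \<Rightarrow> 'a"
    using j unfolding lincomb_restrict by (simp add: lincomb_def if_distrib[of "\<lambda>x. x * _"] cong: if_cong)
  then show "b j = b' j"
    using eq[OF restrict_in_coords[of n "\<lambda>i. if i = j then 1 else 0"]] by simp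
qed

lemma card_costas_polys_ge:
  assumes card: "CARD('a::{field,finite}) = CHAR('a) ^ n"
  shows "card (indep_tuples n :: (nat \<Rightarrow> 'a) set) \<le> card (costas_polys :: 'a poly set)"
proof (cases "indep_tuples n = ({} :: (nat \<Rightarrow> 'a) set)")
  case False
  \<comment> \<open>Any independent tuple serves as the fixed reference basis; if there is none, the
    count on the left is 0.\<close>
  then obtain a :: "nat \<Rightarrow> 'a" where "a \<in> indep_tuples n" by blast
  note a = lincomb_bij_betw[OF card this]
  define F where "F b = lincomb n b \<circ> inv_into (coords n) (lincomb n a)" for b
  obtain P :: "('a \<Rightarrow> 'a) \<Rightarrow> 'a poly" where P: "degree (P f) < CARD('a)" "poly (P f) = f" for f
    using exists_poly_interpolating by metis
  have "bij (F b)" if "b \<in> indep_tuples n" for b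
    unfolding F_def using bij_betw_inv_into[OF a] lincomb_bij_betw[OF card that]
    by (rule bij_betw_trans)
  then have "(\<lambda>b. P (F b)) ` indep_tuples n \<subseteq> costas_polys"
    using additive_change_of_basis[OF a]
    by (auto simp: costas_polys_def P F_def intro!: costas_poly_of_additive_bij)
  moreover have "inj_on (\<lambda>b. P (F b)) (indep_tuples n)"
  proof (rule inj_onI)
    fix b b' assume b: "b \<in> indep_tuples n" "b' \<in> indep_tuples n" and "P (F b) = P (F b')"
    then have "F b = F b'" by (metis P(2))
    then have "lincomb n b c = lincomb n b' c" if "c \<in> coords n" for c
      using bij_betw_inv_into_left[OF a that] by (metis F_def comp_apply)
    then show "b = b'" using b lincomb_tuple_inj by blast
  qed
  \<comment> \<open>Polynomials of degree below the field size that agree at every point are equal,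
    so they embed into the finite set of self-maps.\<close>
  moreover have "finite (costas_polys :: 'a poly set)"
  proof (rule inj_on_finite[of poly _ UNIV])
    show "inj_on poly (costas_polys :: 'a poly set)"
      by (auto simp: inj_on_def costas_polys_def intro!: poly_eqI_degree[of UNIV])
  qed auto
  ultimately show ?thesis by (metis card_inj_on_le)
qed simp

theorem theorem2p2:
  fixes p n q :: nat
  assumes "prime p" and "n \<ge> 1" and "q = p ^ n"
    and "CARD('a::{field,finite}) = q"
  shows "real (card (costas_polys :: 'a poly set)) \<ge>
    real (totient (q - 1)) *
      ((\<Prod>i<n. real q - real p ^ i) / (real n * (real q - 1)))"
proof -
  \<comment> \<open>The characteristic is a prime dividing the field order \<open>p ^ n\<close>,
    which forces it to be \<open>p\<close>.\<close>
  have "CHAR('a) dvd p ^ n" using CHAR_dvd_CARD[where 'a = 'a] assms by simp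
  moreover have "prime CHAR('a)"
    by (simp add: prime_CHAR_semidom finite_imp_CHAR_pos)
  ultimately have char: "CHAR('a) = p"
    using assms(1) by (metis prime_dvd_power primes_dvd_imp_eq)
  have q: "q \<ge> 2"
    using assms prime_ge_2_nat[of p] self_le_power[of p n] by simp
  \<comment> \<open>Hence the natural subtractions do not truncate, and the real product is the cast
    of a natural number, in particular nonnegative.\<close>
  have le: "p ^ i \<le> q" if "i < n" for i
    unfolding assms(3) using that prime_gt_0_nat[OF assms(1)] by (intro power_increasing) auto
  have prod: "(\<Prod>i<n. real q - real p ^ i) = real (\<Prod>i<n. q - p ^ i)"
    unfolding of_nat_prod by (intro prod.cong) (auto simp: of_nat_diff le)
  have "(\<Prod>i<n. q - p ^ i) \<le> card (costas_polys :: 'a poly set)"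
    using card_indep_tuples[of n, where 'a = 'a] card_costas_polys_ge[where 'a = 'a, of n] assms char
    by simp
  then have bound: "(\<Prod>i<n. real q - real p ^ i) \<le> real (card (costas_polys :: 'a poly set))"
    unfolding prod by (simp only: of_nat_le_iff)
  have "totient (q - 1) \<le> n * (q - 1)"
    using totient_le[of "q - 1"] mult_le_mono1[OF assms(2), of "q - 1"] by linarith
  then have "real (totient (q - 1)) \<le> real (n * (q - 1))"
    by (simp only: of_nat_le_iff)
  then have "real (totient (q - 1)) \<le> real n * (real q - 1)"
    using q by (simp add: of_nat_diff)
  \<comment> \<open>The denominator is positive because \<open>n\<close> is at least 1 and
    \<open>q\<close> at least 2.\<close>
  then have "real (totient (q - 1)) / (real n * (real q - 1)) \<le> 1"
    using q assms(2) by simp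
  then have "real (totient (q - 1)) / (real n * (real q - 1)) * (\<Prod>i<n. real q - real p ^ i) \<le>
      1 * (\<Prod>i<n. real q - real p ^ i)"
    by (intro mult_right_mono) (simp_all add: prod del: of_nat_prod)
  with bound show ?thesis by simp
qed

end
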